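(* The competitive ratio of any deterministic online algorithm for $\mathrm{DMCD}$ on directed line networks with $n$ nodes is $\Omega\!\left(\frac{\log n}{\log\log n}\right)$. Consequently, the competitive ratio of any deterministic online algorithm for online RSA is $\Omega\!\left(\frac{\log N}{\log\log N}\right)$, where $N$ is the number of points.
   Context: Time-line graph: for a directed line network with nodes $0,\dots,n$ (edges $(u,u+1)$), the time-line graph has replicas $(v,t)$, $t\in\{0,1,2,\dots\}$, horizontal edges $((u,t),(u+1,t))$ and arcs $((v,t),(v,t+1))$. DMCD: given an origin node and a set of requests (replicas), a feasible solution is a set $F$ of edges such that every request is reachable from the origin at time $0$ by a directed path in $F$; cost $|F|$. Online DMCD: requests arrive in nondecreasing time order; when handling requests of time $t$ the algorithm may add only horizontal edges at time $t$, and at the end of time $t$ only arcs from time $t$ to $t+1$; it cannot delete edges nor add edges at earlier times, and does not know future requests. RSA: points $p_1=(x_1,y_1),\dots,p_N=(x_N,y_N)$ in the positive quadrant must be connected to $(0,0)$ by horizontal/vertical segments so that each point's path from the origin is $x$- and $y$-monotone; cost is total length. Online RSA: points arrive in nondecreasing $y$; segments are never deleted, and segments added when handling $p_i$ must lie in the region $y\ge y_{i-1}$. The competitive ratio is the worst-case ratio of the algorithm's cost to the optimal cost. *)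

theory Defs
  imports "HOL-Analysis.Analysis"
begin

section \<open>Online DMCD on directed line networks\<close>

text \<open>A replica \<open>(v, t)\<close> is the copy of node \<open>v\<close> at time \<open>t\<close>.\<close>

type_synonym replica = "nat \<times> nat"
type_synonym edge = "replica \<times> replica"

definition horizontal_edges :: "nat \<Rightarrow> nat \<Rightarrow> edge set" where
  "horizontal_edges n t = {((u, t), (u + 1, t)) | u. u < n}"

definition arcs :: "nat \<Rightarrow> nat \<Rightarrow> edge set" where
  "arcs n t = {((v, t), (v, t + 1)) | v. v \<le> n}"

definition timeline_edges :: "nat \<Rightarrow> edge set" where
  "timeline_edges n = (\<Union>t. horizontal_edges n t \<union> arcs n t)"

definition dmcd_feasible :: "nat \<Rightarrow> nat \<Rightarrow> replica set \<Rightarrow> edge set \<Rightarrow> bool" where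
  "dmcd_feasible n origin R F \<longleftrightarrow>
     finite F \<and> F \<subseteq> timeline_edges n \<and> (\<forall>r\<in>R. ((origin, 0), r) \<in> F\<^sup>*)"

definition dmcd_opt :: "nat \<Rightarrow> nat \<Rightarrow> replica set \<Rightarrow> nat" where
  "dmcd_opt n origin R = (INF F\<in>{F. dmcd_feasible n origin R F}. card F)"

text \<open>
  Requests are listed in order of arrival. Nodes to the left of the origin are
  unreachable on a directed line, so they cannot be requested.
\<close>

definition dmcd_input :: "nat \<Rightarrow> nat \<Rightarrow> replica list \<Rightarrow> bool" where
  "dmcd_input n origin rs \<longleftrightarrow> origin \<le> n \<and> fst ` set rs \<subseteq> {origin..n} \<and>
     distinct rs \<and> sorted (map snd rs)"

text \<open>
  A deterministic online algorithm consists of two functions of the origin and the history: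
  \<open>serve origin [r\<^sub>1, \<dots>, r\<^sub>i]\<close> is the set of edges added on arrival of \<open>r\<^sub>i\<close>, and
  \<open>store origin rs t\<close> is the set of edges added at the end of time \<open>t\<close>, when the requests
  \<open>rs\<close> are exactly those of times at most \<open>t\<close>. The partial solution built so far is
  determined by the history, so it need not be a further argument.
\<close>

type_synonym dmcd_serve = "nat \<Rightarrow> replica list \<Rightarrow> edge set"
type_synonym dmcd_store = "nat \<Rightarrow> replica list \<Rightarrow> nat \<Rightarrow> edge set"

text \<open>
  The solution at the moment the last request has been handled. The step closing the time of
  the last request is not included: it could only serve later requests.
\<close>

definition dmcd_solution ::
    "dmcd_serve \<Rightarrow> dmcd_store \<Rightarrow> nat \<Rightarrow> replica list \<Rightarrow> edge set" where
  "dmcd_solution serve store origin rs =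
     (\<Union>i\<in>{1..length rs}. serve origin (take i rs)) \<union>
     (\<Union>t\<in>{t. \<exists>r\<in>set rs. t < snd r}. store origin (filter (\<lambda>r. snd r \<le> t) rs) t)"

definition dmcd_online_algorithm :: "nat \<Rightarrow> dmcd_serve \<Rightarrow> dmcd_store \<Rightarrow> bool" where
  "dmcd_online_algorithm n serve store \<longleftrightarrow>
     (\<forall>origin rs. dmcd_input n origin rs \<longrightarrow>
        (rs \<noteq> [] \<longrightarrow> serve origin rs \<subseteq> horizontal_edges n (snd (last rs))) \<and>
        (\<forall>t. (\<forall>r\<in>set rs. snd r \<le> t) \<longrightarrow> store origin rs t \<subseteq> arcs n t) \<and>
        dmcd_feasible n origin (set rs) (dmcd_solution serve store origin rs))"

text \<open>
  Inputs of optimal cost zero are excluded, since no ratio is defined for them.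
\<close>

definition dmcd_competitive_ratio :: "nat \<Rightarrow> dmcd_serve \<Rightarrow> dmcd_store \<Rightarrow> ereal" where
  "dmcd_competitive_ratio n serve store =
     (SUP (origin, rs) \<in> {(origin, rs). dmcd_input n origin rs \<and> dmcd_opt n origin (set rs) > 0}.
        ereal (real (card (dmcd_solution serve store origin rs)) /
               real (dmcd_opt n origin (set rs))))"


section \<open>Online rectilinear Steiner arborescence (RSA)\<close>

type_synonym point = "real \<times> real"

text \<open>A segment is given by its two end points.\<close>

type_synonym segment = "point \<times> point"

definition axis_parallel :: "segment \<Rightarrow> bool" where
  "axis_parallel s \<longleftrightarrow> fst (fst s) = fst (snd s) \<or> snd (fst s) = snd (snd s)"

definition segment_points :: "segment \<Rightarrow> point set" where
  "segment_points s = closed_segment (fst s) (snd s)"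

definition rsa_cost :: "segment set \<Rightarrow> real" where
  "rsa_cost F = (\<Sum>s\<in>F. dist (fst s) (snd s))"

text \<open>
  A monotone rectilinear path is a finite sequence of rightward and upward moves. A move may
  run along several segments and use only parts of them.
\<close>

definition monotone_moves :: "segment set \<Rightarrow> (point \<times> point) set" where
  "monotone_moves F = {(p, q).
     (snd p = snd q \<and> fst p \<le> fst q \<or> fst p = fst q \<and> snd p \<le> snd q) \<and>
     closed_segment p q \<subseteq> (\<Union>s\<in>F. segment_points s)}"

definition rsa_feasible :: "point set \<Rightarrow> segment set \<Rightarrow> bool" where
  "rsa_feasible P F \<longleftrightarrow>
     finite F \<and> (\<forall>s\<in>F. axis_parallel s) \<and> (\<forall>p\<in>P. ((0, 0), p) \<in> (monotone_moves F)\<^sup>*)"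

definition rsa_opt :: "point set \<Rightarrow> real" where
  "rsa_opt P = (INF F\<in>{F. rsa_feasible P F}. rsa_cost F)"

definition rsa_input :: "point list \<Rightarrow> bool" where
  "rsa_input ps \<longleftrightarrow> (\<forall>p\<in>set ps. fst p \<ge> 0 \<and> snd p \<ge> 0) \<and> distinct ps \<and> sorted (map snd ps)"

text \<open>
  A deterministic online algorithm maps the history \<open>[p\<^sub>1, \<dots>, p\<^sub>i]\<close> to the set of
  segments added on arrival of \<open>p\<^sub>i\<close>. These lie at or above the height of \<open>p\<^sub>i\<^sub>-\<^sub>1\<close>,
  where the origin plays the role of \<open>p\<^sub>0\<close>.
\<close>

type_synonym rsa_alg = "point list \<Rightarrow> segment set"

definition previous_height :: "point list \<Rightarrow> real" where
  "previous_height ps = snd (last ((0, 0) # butlast ps))"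

definition rsa_solution :: "rsa_alg \<Rightarrow> point list \<Rightarrow> segment set" where
  "rsa_solution alg ps = (\<Union>i\<in>{1..length ps}. alg (take i ps))"

definition rsa_online_algorithm :: "rsa_alg \<Rightarrow> bool" where
  "rsa_online_algorithm alg \<longleftrightarrow>
     (\<forall>ps. rsa_input ps \<longrightarrow>
        (ps \<noteq> [] \<longrightarrow> (\<forall>s\<in>alg ps. segment_points s \<subseteq> {q. snd q \<ge> previous_height ps})) \<and>
        rsa_feasible (set ps) (rsa_solution alg ps))"

definition rsa_competitive_ratio :: "nat \<Rightarrow> rsa_alg \<Rightarrow> ereal" where
  "rsa_competitive_ratio N alg =
     (SUP ps \<in> {ps. rsa_input ps \<and> length ps = N \<and> rsa_opt (set ps) > 0}.
        ereal (rsa_cost (rsa_solution alg ps) / rsa_opt (set ps)))"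

end

theory Submission
  imports Defs "HOL-Real_Asymp.Real_Asymp"
begin

text \<open>
  At every time \<open>t\<close> the adversary requests \<open>(t, t)\<close> and one more replica \<open>(t - k\<^sub>t, t)\<close>.
  Let \<open>m\<close> be such that \<open>(m + 1)^m\<close> is at most \<open>n / 2\<close>. The \<open>m\<close> intervals
  \<open>(t - (m + 1)^(i + 1), t - (m + 1)^i]\<close> with \<open>i < m\<close> are disjoint. If the algorithm has at
  least \<open>m\<close> columns just before \<open>t\<close>, it pays \<open>m\<close> for them, and \<open>k\<^sub>t = 1\<close>. Otherwise some interval
  is free of columns, and for \<open>k\<^sub>t = (m + 1)^i\<close> the algorithm has to cross it horizontally at
  cost \<open>m k\<^sub>t\<close>. In both cases it pays \<open>m k\<^sub>t\<close>, whereas the diagonal staircase together with a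
  column of length \<open>k\<^sub>t\<close> from the diagonal up to each extra request costs only the sum of
  \<open>2 + k\<^sub>t\<close> over all \<open>t\<close>. One may take \<open>m\<close> of order \<open>ln n / ln (ln n)\<close>.

  A DMCD solution is a set of unit segments in the plane, so both problems share this argument.
\<close>

section \<open>Segments, columns and monotone paths\<close>

definition vertical :: "segment \<Rightarrow> bool" where
  "vertical s \<longleftrightarrow> fst (fst s) = fst (snd s)"

text \<open>A column is recorded by its abscissa alone, so overlapping segments on one vertical line
  count once. The number of columns is thus a lower bound for the number of vertical segments
  met.\<close>

definition columns :: "segment set \<Rightarrow> real \<Rightarrow> real set" where
  "columns F y = {x. \<exists>s\<in>F. vertical s \<and> (x, y) \<in> segment_points s}"

abbreviation x_range :: "segment \<Rightarrow> real set" where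
  "x_range s \<equiv> closed_segment (fst (fst s)) (fst (snd s))"

abbreviation y_range :: "segment \<Rightarrow> real set" where
  "y_range s \<equiv> closed_segment (snd (fst s)) (snd (snd s))"

lemma segment_pointsD:
  "(x, y) \<in> segment_points s \<Longrightarrow> x \<in> x_range s \<and> y \<in> y_range s"
  by (cases s; cases "fst s"; cases "snd s") (auto simp: segment_points_def dest: closed_segment_PairD)

lemma segment_points_vertical:
  "vertical s \<Longrightarrow> segment_points s = {fst (fst s)} \<times> y_range s"
  unfolding segment_points_def vertical_def
  by (metis closed_segment_same_fst prod.collapse)

section \<open>Lengths as Lebesgue measures of projections\<close>

lemma dist_vertical: "vertical s \<Longrightarrow> dist (fst s) (snd s) = measure lborel (y_range s)"
  by (auto simp: vertical_def dist_prod_def dist_real_def closed_segment_eq_real_ivl abs_if)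

lemma dist_horizontal:
  "axis_parallel s \<Longrightarrow> \<not> vertical s \<Longrightarrow> dist (fst s) (snd s) = measure lborel (x_range s)"
  by (auto simp: vertical_def axis_parallel_def dist_prod_def dist_real_def closed_segment_eq_real_ivl abs_if)

text \<open>With lengths written as measures of projections, costs can be bounded by integrating
  over heights or abscissas. A degenerate segment counts as vertical and contributes zero.\<close>

lemma rsa_cost_split:
  assumes "finite F" "\<forall>s\<in>F. axis_parallel s"
  shows "rsa_cost F = (\<Sum>s\<in>{s\<in>F. vertical s}. measure lborel (y_range s)) +
     (\<Sum>s\<in>{s\<in>F. \<not> vertical s}. measure lborel (x_range s))"
proof -
  have "rsa_cost F = (\<Sum>s\<in>{s\<in>F. vertical s}. dist (fst s) (snd s)) +
     (\<Sum>s\<in>{s\<in>F. \<not> vertical s}. dist (fst s) (snd s))"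
    unfolding rsa_cost_def using assms(1)
    by (subst sum.union_disjoint[symmetric]) (auto intro!: sum.cong)
  also have "(\<Sum>s\<in>{s\<in>F. vertical s}. dist (fst s) (snd s)) = (\<Sum>s\<in>{s\<in>F. vertical s}. measure lborel (y_range s))"
    by (rule sum.cong) (auto simp: dist_vertical)
  also have "(\<Sum>s\<in>{s\<in>F. \<not> vertical s}. dist (fst s) (snd s)) = (\<Sum>s\<in>{s\<in>F. \<not> vertical s}. measure lborel (x_range s))"
    using assms(2) by (intro sum.cong) (auto simp: dist_horizontal)
  finally show ?thesis .
qed

lemma card_columns_le:
  assumes "finite F"
  shows "finite (columns F y)" "card (columns F y) \<le> card {s\<in>F. vertical s \<and> y \<in> y_range s}"
proof -
  have "columns F y \<subseteq> (\<lambda>s. fst (fst s)) ` {s\<in>F. vertical s \<and> y \<in> y_range s}"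
    by (force simp: columns_def segment_points_vertical)
  then show "finite (columns F y)" "card (columns F y) \<le> card {s\<in>F. vertical s \<and> y \<in> y_range s}"
    using assms by (auto intro: finite_subset surj_card_le)
qed

text \<open>Double counting: the right-hand side is the integral over \<open>{a..<b}\<close> of the
  number of sets \<open>I s\<close> containing \<open>y\<close>, and this number is at least
  \<open>m\<close> off the null set \<open>E\<close>. It serves for vertical segments over heights
  and for horizontal segments over abscissas.\<close>

lemma multiple_cover_bound:
  fixes I :: "'a \<Rightarrow> real set"
  assumes "finite S" "finite E" "a \<le> b" "\<And>s. s \<in> S \<Longrightarrow> I s \<in> sets borel"
    and cover: "\<And>y. a \<le> y \<Longrightarrow> y < b \<Longrightarrow> y \<notin> E \<Longrightarrow> m \<le> card {s\<in>S. y \<in> I s}"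
  shows "real m * (b - a) \<le> (\<Sum>s\<in>S. measure lborel ({a..<b} \<inter> I s))"
proof -
  have fin: "emeasure lborel (A \<inter> {a..<b}) < \<infinity>" for A
    by (rule le_less_trans[OF emeasure_mono[of _ "{a..<b}"]]) (use assms(3) in auto)
  have "real m * (b - a) = real m * measure lborel ({a..<b} - E)"
    using assms(2,3) by (simp add: measure_Diff_null_set finite_imp_null_set_lborel)
  also have "\<dots> = (LINT y|lborel. real m * indicator ({a..<b} - E) y)"
    using assms(2) by (simp add: finite_imp_closed)
  also have "\<dots> \<le> (LINT y|lborel. (\<Sum>s\<in>S. indicator ({a..<b} \<inter> I s) y))"
  proof (rule integral_mono)
    show "integrable lborel (\<lambda>y. real m * indicator ({a..<b} - E) y)"
      using assms(2) fin[of "- E"]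
      by (auto intro!: integrable_mult_right integrable_real_indicator simp: finite_imp_closed Diff_eq Int_commute)
    show "integrable lborel (\<lambda>y. \<Sum>s\<in>S. indicator ({a..<b} \<inter> I s) y :: real)"
      using assms(4) fin by (auto intro!: Bochner_Integration.integrable_sum integrable_real_indicator simp: Int_commute)
    fix y
    show "real m * indicator ({a..<b} - E) y \<le> (\<Sum>s\<in>S. indicator ({a..<b} \<inter> I s) y)"
    proof (cases "y \<in> {a..<b} - E")
      case True
      then have "(\<Sum>s\<in>S. indicator ({a..<b} \<inter> I s) y :: real) = real (card {s\<in>S. y \<in> I s})"
        using assms(1) by (simp add: indicator_def sum.If_cases Int_def)
      then show ?thesis using cover[of y] True by simp
    qed (auto intro!: sum_nonneg)
  qed
  also have "\<dots> = (\<Sum>s\<in>S. LINT y|lborel. indicator ({a..<b} \<inter> I s) y)"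
    using assms(4) fin
    by (intro Bochner_Integration.integral_sum integrable_real_indicator) (auto simp: Int_commute)
  also have "\<dots> = (\<Sum>s\<in>S. measure lborel ({a..<b} \<inter> I s))"
    by (intro sum.cong) (auto simp: assms(4))
  finally show ?thesis .
qed

text \<open>A monotone path passes height \<open>y\<close> upward along some column. It never turns
  left afterwards, so its rightward moves above \<open>y\<close> sweep every abscissa from that
  column to \<open>fst p\<close>. Abscissas of vertical segments are exempt, because there a
  rightward move may be covered by a point of a vertical segment; they are finitely many. The
  induction follows the moves of the path.\<close>

lemma monotone_path_crossing:
  assumes F: "finite F" "\<forall>s\<in>F. axis_parallel s"
    and path: "((0, 0), p) \<in> (monotone_moves F)\<^sup>*" and y: "0 \<le> y" "y < snd p"
  obtains x where "x \<in> columns F y" "x \<le> fst p"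
    "\<And>x'. x \<le> x' \<Longrightarrow> x' \<le> fst p \<Longrightarrow> x' \<notin> (\<lambda>s. fst (fst s)) ` {s\<in>F. vertical s} \<Longrightarrow>
       \<exists>s\<in>F. \<not> vertical s \<and> y < snd (fst s) \<and> snd (fst s) \<le> snd p \<and> x' \<in> x_range s"
proof -
  let ?V = "(\<lambda>s. fst (fst s)) ` {s\<in>F. vertical s}"
  from path have "y < snd p \<longrightarrow> (\<exists>x\<in>columns F y. x \<le> fst p \<and> (\<forall>x'. x \<le> x' \<and> x' \<le> fst p \<and> x' \<notin> ?V \<longrightarrow>
       (\<exists>s\<in>F. \<not> vertical s \<and> y < snd (fst s) \<and> snd (fst s) \<le> snd p \<and> x' \<in> x_range s)))"
    (is "_ \<longrightarrow> ?crossing p")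
  proof (induction rule: rtrancl_induct)
    case base
    then show ?case using y(1) by simp
  next
    case (step q p)
    from step.hyps(2) have covered: "closed_segment q p \<subseteq> (\<Union>s\<in>F. segment_points s)"
      and move: "snd q = snd p \<and> fst q \<le> fst p \<or> fst q = fst p \<and> snd q \<le> snd p"
      by (auto simp: monotone_moves_def)
    show ?case
    proof
      assume "y < snd p"
      show "?crossing p"
      proof (cases "y < snd q")
        case True
        then obtain x where x: "x \<in> columns F y" "x \<le> fst q"
          "\<And>x'. x \<le> x' \<Longrightarrow> x' \<le> fst q \<Longrightarrow> x' \<notin> ?V \<Longrightarrow>
            \<exists>s\<in>F. \<not> vertical s \<and> y < snd (fst s) \<and> snd (fst s) \<le> snd q \<and> x' \<in> x_range s"
          using step.IH by blast
        have "\<exists>s\<in>F. \<not> vertical s \<and> y < snd (fst s) \<and> snd (fst s) \<le> snd p \<and> x' \<in> x_range s"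
          if x': "x \<le> x'" "x' \<le> fst p" "x' \<notin> ?V" for x'
        proof (cases "x' \<le> fst q")
          case True
          with x(3)[OF x'(1) True x'(3)] move show ?thesis by force
        next
          case False
          with move x'(2) have h: "snd q = snd p" "fst q \<le> fst p" by auto
          \<comment> \<open>The new abscissas belong to a rightward move at height
            \<open>snd p\<close>.\<close>
          have "(x', snd p) \<in> closed_segment q p"
            using closed_segment_same_snd[OF h(1)] h x'(2) False by (simp add: closed_segment_eq_real_ivl)
          with covered obtain s where s: "s \<in> F" "(x', snd p) \<in> segment_points s" by blast
          have nv: "\<not> vertical s"
            using s x'(3) by (auto simp: segment_points_vertical)
          with F(2) s(1) have "snd (fst s) = snd (snd s)"
            by (auto simp: axis_parallel_def vertical_def)
          with segment_pointsD[OF s(2)] s(1) nv \<open>y < snd p\<close> show ?thesis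
            by (intro bexI[of _ s]) auto
        qed
        moreover have "x \<le> fst p" using x(2) move by auto
        ultimately show ?thesis using x(1) by blast
      next
        case False
        \<comment> \<open>This is the upward move that passes height \<open>y\<close>; its abscissa
          becomes \<open>x\<close>.\<close>
        with \<open>y < snd p\<close> move have h: "fst q = fst p" "snd q \<le> y" by auto
        \<comment> \<open>The point at height \<open>y\<close> itself might lie on a horizontal
          segment only. Just above \<open>y\<close>, however, all but finitely many points of the
          move lie on vertical segments. Their heights form the closed set \<open>K\<close>, which
          therefore contains its limit point \<open>y\<close>.\<close>
        define K where "K = (\<Union>s\<in>{s\<in>F. vertical s \<and> fst (fst s) = fst p}. y_range s)"
        have "closed K" unfolding K_def using F(1) by (intro closed_UN) auto
        have "{y<..<snd p} \<subseteq> K \<union> (\<lambda>s. snd (fst s)) ` F"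
        proof
          fix z assume z: "z \<in> {y<..<snd p}"
          have "(fst p, z) \<in> closed_segment q p"
            using closed_segment_same_fst[OF h(1)] h z by (simp add: closed_segment_eq_real_ivl)
          with covered obtain s where s: "s \<in> F" "(fst p, z) \<in> segment_points s" by blast
          show "z \<in> K \<union> (\<lambda>s. snd (fst s)) ` F"
          proof (cases "vertical s")
            case True
            then have "fst (fst s) = fst p" "z \<in> y_range s" using s by (auto simp: segment_points_vertical)
            with True s(1) show ?thesis unfolding K_def by blast
          next
            case nv: False
            with F(2) s(1) have "snd (fst s) = snd (snd s)"
              by (auto simp: axis_parallel_def vertical_def)
            then have "z = snd (fst s)" using segment_pointsD[OF s(2)] by auto
            with s(1) show ?thesis by blast
          qed
        qed
        moreover have "y islimpt {y<..<snd p}"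
          using \<open>y < snd p\<close> by (simp add: islimpt_greaterThanLessThan1)
        ultimately have "y islimpt ((\<lambda>s. snd (fst s)) ` F \<union> K)"
          by (subst Un_commute) (rule islimpt_subset)
        then have "y \<in> K"
          using F(1) \<open>closed K\<close> by (simp add: islimpt_Un_finite closed_limpt)
        then obtain s where s: "s \<in> F" "vertical s" "fst (fst s) = fst p" "y \<in> y_range s"
          by (auto simp: K_def)
        then have "fst p \<in> columns F y"
          by (auto simp: columns_def segment_points_vertical intro!: bexI[of _ s])
        moreover have "fst p \<in> ?V" using s by (auto intro!: rev_image_eqI)
        \<comment> \<open>For \<open>x = fst p\<close> the only candidate is
          \<open>x' = fst p\<close>, which is exempt.\<close>
        ultimately show ?thesis by (intro bexI[of _ "fst p"]) (auto dest: antisym)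
      qed
    qed
  qed
  with y(2) that show ?thesis by blast
qed

section \<open>The adversary\<close>

definition embed :: "replica \<Rightarrow> point" where
  "embed r = (real (fst r), real (snd r))"

text \<open>Later \<open>pre\<close> is empty or consists of the origin, which allows an odd number
  of requests.\<close>

primrec requests :: "(nat \<Rightarrow> nat) \<Rightarrow> replica list \<Rightarrow> nat \<Rightarrow> replica list" where
  "requests k pre 0 = pre"
| "requests k pre (Suc t) = requests k pre t @ [(Suc t - k (Suc t), Suc t), (Suc t, Suc t)]"

text \<open>The lower bound keeps the two requests of a round distinct; the upper bound keeps the
  truncated subtraction \<open>t - k t\<close> exact.\<close>

definition valid_offsets :: "(nat \<Rightarrow> nat) \<Rightarrow> bool" where
  "valid_offsets k \<longleftrightarrow> (\<forall>t\<ge>1. 1 \<le> k t \<and> k t \<le> t)"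

lemma set_requests:
  "set (requests k pre n) = set pre \<union> (\<Union>t\<in>{1..n}. {(t - k t, t), (t, t)})"
  by (induction n) (auto simp: atLeastAtMostSuc_conv)

text \<open>Pigeonhole on \<open>m\<close> disjoint intervals. Their ends grow geometrically, so the
  far end of a gap is \<open>m + 1\<close> times as distant from \<open>c\<close> as its near end
  \<open>k\<close>, and crossing it costs \<open>m * k\<close>.\<close>

lemma free_gap:
  fixes c :: real
  assumes "finite A" "card A < m"
  obtains i where "i < m" "A \<inter> {c - real (m + 1) ^ Suc i <.. c - real (m + 1) ^ i} = {}"
proof (rule ccontr)
  assume "\<not> thesis"
  with that have "\<forall>i\<in>{..<m}. \<exists>x. x \<in> A \<inter> {c - real (m + 1) ^ Suc i <.. c - real (m + 1) ^ i}"
    by blast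
  from bchoice[OF this] obtain g where
    g: "\<And>i. i < m \<Longrightarrow> g i \<in> A \<and> c - real (m + 1) ^ Suc i < g i \<and> g i \<le> c - real (m + 1) ^ i"
    by auto
  have "g j < g i" if "i < j" "j < m" for i j
  proof -
    have "real (m + 1) ^ Suc i \<le> real (m + 1) ^ j"
      using that by (intro power_increasing) auto
    with g[of i] g[of j] that show ?thesis by linarith
  qed
  then have "inj_on g {..<m}"
    by (intro inj_onI) (metis lessThan_iff less_irrefl linorder_neqE_nat)
  moreover have "g ` {..<m} \<subseteq> A" using g by auto
  ultimately have "m \<le> card A" using assms(1) by (metis card_inj_on_le card_lessThan)
  with assms(2) show False by simp
qed

text \<open>
  A point at height \<open>t\<close> may be served by segments starting at height \<open>t - 1\<close>, so only the
  columns below \<open>t - 1\<close> are already committed when its offset is chosen.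
\<close>

definition good_offset :: "nat \<Rightarrow> segment set \<Rightarrow> nat \<Rightarrow> nat \<Rightarrow> bool" where
  "good_offset m F t k \<longleftrightarrow> 1 \<le> k \<and> k \<le> t \<and> (t < (m + 1) ^ m \<longrightarrow> k = 1) \<and> ((m + 1) ^ m \<le> t \<longrightarrow>
     k = 1 \<and> (\<forall>y\<in>{real t - 2..<real t - 1}. m \<le> card (columns F y)) \<or>
     (\<exists>y\<in>{real t - 2..<real t - 1}. columns F y \<inter> {real t - real ((m + 1) * k) <.. real t - real k} = {}))"

lemma good_offset_exists:
  assumes "finite F" "1 \<le> t"
  shows "\<exists>k. good_offset m F t k"
proof (cases "(m + 1) ^ m \<le> t \<and> (\<exists>y\<in>{real t - 2..<real t - 1}. card (columns F y) < m)")
  case True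
  then obtain y where y: "y \<in> {real t - 2..<real t - 1}" "card (columns F y) < m" by blast
  obtain i where i: "i < m"
    "columns F y \<inter> {real t - real (m + 1) ^ Suc i <.. real t - real (m + 1) ^ i} = {}"
    using free_gap[OF card_columns_le(1)[OF assms(1)] y(2)] by blast
  \<comment> \<open>Rounds before \<open>(m + 1) ^ m\<close> always use offset 1; from then on every
    offset \<open>(m + 1) ^ i\<close> fits below \<open>t\<close>.\<close>
  have "(m + 1) ^ i \<le> (m + 1) ^ m" using i(1) by (intro power_increasing) auto
  also have "\<dots> \<le> t" using True by simp
  finally have "(m + 1) ^ i \<le> t" .
  moreover have "columns F y \<inter> {real t - real ((m + 1) * (m + 1) ^ i) <.. real t - real ((m + 1) ^ i)} = {}"
    using i(2) by (simp only: of_nat_mult of_nat_power power_Suc)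
  moreover have "1 \<le> (m + 1) ^ i" by simp
  ultimately have "good_offset m F t ((m + 1) ^ i)"
    unfolding good_offset_def using True y(1) not_less by blast
  then show ?thesis ..
next
  case False
  with assms(2) show ?thesis
    by (intro exI[of _ 1]) (auto simp: good_offset_def not_less)
qed

text \<open>The offset of round \<open>t\<close> depends on the solution for the earlier requests,
  which are built from \<open>k\<close> itself. This is not circular: those requests involve only
  earlier values of \<open>k\<close>. A choice function on histories and recursion therefore yield
  one fixed \<open>k\<close>.\<close>

lemma adaptive_offsets:
  fixes sol :: "replica list \<Rightarrow> segment set"
  obtains k where "valid_offsets k"
    "\<And>t. 1 \<le> t \<Longrightarrow> finite (sol (requests k pre (t - 1))) \<Longrightarrow>
       good_offset m (sol (requests k pre (t - 1))) t (k t)"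
proof -
  \<comment> \<open>The bounds on the offset are demanded even for infinite \<open>sol H\<close>:
    finiteness will be derived from feasibility, which is available for valid offsets only.\<close>
  have "\<exists>k. 1 \<le> t \<longrightarrow> 1 \<le> k \<and> k \<le> t \<and> (finite (sol H) \<longrightarrow> good_offset m (sol H) t k)" for H t
    using good_offset_exists[of "sol H" t m] by (metis good_offset_def order_refl)
  then have "\<forall>Ht. \<exists>k. 1 \<le> snd Ht \<longrightarrow> 1 \<le> k \<and> k \<le> snd Ht \<and>
      (finite (sol (fst Ht)) \<longrightarrow> good_offset m (sol (fst Ht)) (snd Ht) k)" by blast
  from choice[OF this] obtain g where g: "\<And>Ht. 1 \<le> snd Ht \<Longrightarrow> 1 \<le> g Ht \<and> g Ht \<le> snd Ht \<and>
      (finite (sol (fst Ht)) \<longrightarrow> good_offset m (sol (fst Ht)) (snd Ht) (g Ht))" by blast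
  define f where "f H t = g (H, t)" for H t
  have f: "1 \<le> f H t \<and> f H t \<le> t \<and> (finite (sol H) \<longrightarrow> good_offset m (sol H) t (f H t))"
    if "1 \<le> t" for H t
    using g[of "(H, t)"] that by (simp add: f_def)
  \<comment> \<open>The request list is built first, and \<open>k\<close> is then read off from
    it.\<close>
  define hist where "hist = rec_nat pre (\<lambda>t H. H @ [(Suc t - f H (Suc t), Suc t), (Suc t, Suc t)])"
  define k where "k t = f (hist (t - 1)) t" for t
  have hist: "hist t = requests k pre t" for t
    by (induction t) (simp_all add: hist_def k_def)
  have "k t = f (requests k pre (t - 1)) t" for t
    by (simp only: k_def[of t] hist)
  with f that[of k] show thesis by (simp add: valid_offsets_def)
qed

text \<open>The strips of different rounds are disjoint, so no vertical length is charged
  twice.\<close>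

lemma sum_strips_le:
  fixes l u :: real
  assumes "finite A"
  shows "(\<Sum>t\<in>A. measure lborel ({real t - 2..<real t - 1} \<inter> closed_segment l u))
    \<le> measure lborel (closed_segment l u)"
proof -
  have fin: "emeasure lborel (X \<inter> closed_segment l u) < \<infinity>" for X
    by (rule le_less_trans[OF emeasure_mono[of _ "closed_segment l u"]])
      (auto simp: closed_segment_eq_real_ivl)
  have "(\<Sum>t\<in>A. measure lborel ({real t - 2..<real t - 1} \<inter> closed_segment l u))
      = measure lborel (\<Union>t\<in>A. {real t - 2..<real t - 1} \<inter> closed_segment l u)"
  proof (rule measure_finite_Union[symmetric])
    have "a = b" if "real a - 2 \<le> x" "x < real a - 1" "real b - 2 \<le> x" "x < real b - 1" for a b x
      using that by linarith
    then show "disjoint_family_on (\<lambda>t. {real t - 2..<real t - 1} \<inter> closed_segment l u) A"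
      by (auto simp: disjoint_family_on_def)
  qed (use assms fin in \<open>auto simp: less_top[symmetric]\<close>)
  also have "\<dots> \<le> measure lborel (closed_segment l u)"
    using assms fin[of UNIV]
    by (intro measure_mono_fmeasurable) (auto simp: fmeasurable_def)
  finally show ?thesis .
qed

text \<open>
  The factor 2 arises because the gain of round \<open>t\<close> is found among horizontal segments of
  heights in \<open>(t - 2, t]\<close>, so every height is counted in two rounds.
\<close>

lemma adversary:
  fixes sol :: "replica list \<Rightarrow> segment set"
  assumes "1 \<le> m"
    and feasible: "\<And>k. valid_offsets k \<Longrightarrow>
      rsa_feasible (embed ` set (requests k pre n)) (sol (requests k pre n))"
    and increasing: "\<And>k t. valid_offsets k \<Longrightarrow> t \<le> n \<Longrightarrow>
      sol (requests k pre t) \<subseteq> sol (requests k pre n)"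
    and online: "\<And>k t s. valid_offsets k \<Longrightarrow> t \<le> n \<Longrightarrow>
      s \<in> sol (requests k pre n) - sol (requests k pre t) \<Longrightarrow> segment_points s \<subseteq> {q. real t \<le> snd q}"
  obtains k where "valid_offsets k" "\<forall>t\<in>{1..n}. t < (m + 1) ^ m \<longrightarrow> k t = 1"
    "real m * real (\<Sum>t=(m + 1) ^ m..n. k t) \<le> 2 * rsa_cost (sol (requests k pre n))"
proof -
  obtain k where k: "valid_offsets k"
    "\<And>t. 1 \<le> t \<Longrightarrow> finite (sol (requests k pre (t - 1))) \<Longrightarrow>
       good_offset m (sol (requests k pre (t - 1))) t (k t)"
    using adaptive_offsets[of sol pre m] by blast
  define F where "F = sol (requests k pre n)"
  define past where "past t = sol (requests k pre (t - 1))" for t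
  \<comment> \<open>Round \<open>t\<close> is paid for by \<open>V t\<close> if there are many
    columns, and by \<open>W t\<close> if there is a gap.\<close>
  define V where "V t = (\<Sum>s\<in>{s\<in>F. vertical s}.
    measure lborel ({real t - 2..<real t - 1} \<inter> y_range s))" for t :: nat
  define W where "W t = (\<Sum>s\<in>{s\<in>F. \<not> vertical s \<and> real t - 2 < snd (fst s) \<and> snd (fst s) \<le> real t}.
    measure lborel (x_range s))" for t :: nat
  have F: "finite F" "\<forall>s\<in>F. axis_parallel s"
    and paths: "\<And>p. p \<in> set (requests k pre n) \<Longrightarrow> ((0, 0), embed p) \<in> (monotone_moves F)\<^sup>*"
    using feasible[OF k(1)] by (auto simp: rsa_feasible_def F_def)
  have past: "past t \<subseteq> F" "finite (past t)" "good_offset m (past t) t (k t)" if t: "t \<in> {1..n}" for t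
  proof -
    have "t - 1 \<le> n" using t by (meson atLeastAtMost_iff diff_le_self order_trans)
    then show past: "past t \<subseteq> F" "finite (past t)"
      using increasing[OF k(1)] F(1) finite_subset unfolding past_def F_def by blast+
    then show "good_offset m (past t) t (k t)"
      using k(2)[of t] t by (simp add: past_def)
  qed
  have gain: "real m * real (k t) \<le> V t + W t" if t: "t \<in> {(m + 1) ^ m..n}" for t
  proof -
    \<comment> \<open>With \<open>t\<close> at least 2, the strip of round \<open>t\<close> starts
      at a nonnegative height, as \<open>monotone_path_crossing\<close> requires.\<close>
    have "2 ^ 1 \<le> (m + 1) ^ 1" using \<open>1 \<le> m\<close> by simp
    also have "\<dots> \<le> (m + 1) ^ m" using \<open>1 \<le> m\<close> by (intro power_increasing) auto
    finally have "2 \<le> t" using t by simp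
    then have "t \<in> {1..n}" "t - 1 \<le> n" using t by auto
    note past = past[OF this(1)]
    \<comment> \<open>Segments added after round \<open>t - 1\<close> stay at or above height
      \<open>t - 1\<close>, so the columns in the strip are final when \<open>k t\<close> is
      chosen.\<close>
    have same_columns: "columns F y = columns (past t) y" if "y \<in> {real t - 2..<real t - 1}" for y
    proof -
      have "s \<in> past t" if "s \<in> F" "(x, y) \<in> segment_points s" for s x
      proof (rule ccontr)
        assume "s \<notin> past t"
        with that online[OF k(1) \<open>t - 1 \<le> n\<close>, of s] have "real (t - 1) \<le> y"
          by (auto simp: past_def F_def)
        moreover have "real (t - 1) = real t - 1" using \<open>2 \<le> t\<close> by simp
        ultimately show False using \<open>y \<in> _\<close> by simp
      qed
      with past(1) show ?thesis by (auto simp: columns_def)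
    qed
    have nonneg: "0 \<le> V t" "0 \<le> W t" by (auto simp: V_def W_def intro!: sum_nonneg)
    from past(3) consider (dense) "k t = 1" "\<forall>y\<in>{real t - 2..<real t - 1}. m \<le> card (columns (past t) y)"
      | (gap) y where "y \<in> {real t - 2..<real t - 1}"
        "columns (past t) y \<inter> {real t - real ((m + 1) * k t) <.. real t - real (k t)} = {}"
      using t by (auto simp: good_offset_def)
    then show ?thesis
    proof cases
      case dense
      \<comment> \<open>The strip has height 1 and \<open>k t = 1\<close>, so \<open>m\<close>
        columns throughout amount to vertical length \<open>m * k t\<close>.\<close>
      have "real m * ((real t - 1) - (real t - 2)) \<le> V t"
        unfolding V_def
      proof (rule multiple_cover_bound[where E = "{}"])
        fix y assume "real t - 2 \<le> y" "y < real t - 1"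
        then have "m \<le> card (columns F y)" using dense same_columns by simp
        also have "\<dots> \<le> card {s\<in>F. vertical s \<and> y \<in> y_range s}" by (rule card_columns_le(2)[OF F(1)])
        finally show "m \<le> card {s\<in>{s\<in>F. vertical s}. y \<in> y_range s}" by (simp add: conj_assoc)
      qed (use F in auto)
      with nonneg dense show ?thesis by simp
    next
      case gap
      have kt: "1 \<le> k t" "k t \<le> t" using past(3) by (auto simp: good_offset_def)
      have "(t - k t, t) \<in> set (requests k pre n)"
        using t \<open>2 \<le> t\<close> by (auto simp: set_requests)
      from paths[OF this] have path: "((0, 0), (real t - real (k t), real t)) \<in> (monotone_moves F)\<^sup>*"
        using kt by (simp add: embed_def of_nat_diff)
      obtain x where x: "x \<in> columns F y" "x \<le> real t - real (k t)"
        "\<And>x'. x \<le> x' \<Longrightarrow> x' \<le> real t - real (k t) \<Longrightarrow> x' \<notin> (\<lambda>s. fst (fst s)) ` {s\<in>F. vertical s} \<Longrightarrow>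
          \<exists>s\<in>F. \<not> vertical s \<and> y < snd (fst s) \<and> snd (fst s) \<le> real t \<and> x' \<in> x_range s"
        using monotone_path_crossing[OF F path, of y] gap(1) \<open>2 \<le> t\<close> by auto
      \<comment> \<open>The column used by the path cannot lie in the gap, hence lies to its left,
        and the path has to cross the whole gap.\<close>
      have "x \<le> real t - real ((m + 1) * k t)"
        using gap x(1,2) same_columns[of y] by force
      then have "real m * real (k t) \<le> real 1 * ((real t - real (k t)) - x)"
        by (simp add: algebra_simps)
      also have "\<dots> \<le> (\<Sum>s\<in>{s\<in>F. \<not> vertical s \<and> real t - 2 < snd (fst s) \<and> snd (fst s) \<le> real t}.
          measure lborel ({x..<real t - real (k t)} \<inter> x_range s))"
      proof (rule multiple_cover_bound[where E = "(\<lambda>s. fst (fst s)) ` {s\<in>F. vertical s}"])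
        fix x' assume x': "x \<le> x'" "x' < real t - real (k t)" "x' \<notin> (\<lambda>s. fst (fst s)) ` {s\<in>F. vertical s}"
        then obtain s where "s \<in> F" "\<not> vertical s" "y < snd (fst s)" "snd (fst s) \<le> real t" "x' \<in> x_range s"
          using x(3)[of x'] by auto
        with gap(1) have "s \<in> {s \<in> {s\<in>F. \<not> vertical s \<and> real t - 2 < snd (fst s) \<and> snd (fst s) \<le> real t}. x' \<in> x_range s}"
          by auto
        moreover have "finite {s \<in> {s\<in>F. \<not> vertical s \<and> real t - 2 < snd (fst s) \<and> snd (fst s) \<le> real t}. x' \<in> x_range s}"
          using F(1) by simp
        ultimately show "1 \<le> card {s \<in> {s\<in>F. \<not> vertical s \<and> real t - 2 < snd (fst s) \<and> snd (fst s) \<le> real t}. x' \<in> x_range s}"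
          unfolding One_nat_def Suc_le_eq card_gt_0_iff by blast
      qed (use F x(2) in auto)
      also have "\<dots> \<le> W t"
        unfolding W_def
        by (intro sum_mono measure_mono_fmeasurable) (auto simp: closed_segment_eq_real_ivl fmeasurable_def)
      finally show ?thesis using nonneg by simp
    qed
  qed
  let ?T = "{(m + 1) ^ m..n}"
  have "(\<Sum>t\<in>?T. V t) = (\<Sum>s\<in>{s\<in>F. vertical s}. \<Sum>t\<in>?T. measure lborel ({real t - 2..<real t - 1} \<inter> y_range s))"
    unfolding V_def by (rule sum.swap)
  also have "\<dots> \<le> (\<Sum>s\<in>{s\<in>F. vertical s}. measure lborel (y_range s))"
    by (intro sum_mono sum_strips_le) simp
  finally have sum_V: "(\<Sum>t\<in>?T. V t) \<le> (\<Sum>s\<in>{s\<in>F. vertical s}. measure lborel (y_range s))" .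
  have "(\<Sum>t\<in>?T. W t) = (\<Sum>t\<in>?T. \<Sum>s\<in>{s\<in>F. \<not> vertical s}.
      if real t - 2 < snd (fst s) \<and> snd (fst s) \<le> real t then measure lborel (x_range s) else 0)"
    unfolding W_def using F(1) by (intro sum.cong refl sum.mono_neutral_cong_left) auto
  also have "\<dots> = (\<Sum>s\<in>{s\<in>F. \<not> vertical s}. \<Sum>t\<in>?T.
      if real t - 2 < snd (fst s) \<and> snd (fst s) \<le> real t then measure lborel (x_range s) else 0)"
    by (rule sum.swap)
  also have "\<dots> \<le> (\<Sum>s\<in>{s\<in>F. \<not> vertical s}. 2 * measure lborel (x_range s))"
  proof (rule sum_mono)
    fix s :: segment
    let ?h = "snd (fst s)"
    \<comment> \<open>The integers in the half-open interval from \<open>?h\<close> to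
      \<open>?h + 2\<close> are the ceiling of \<open>?h\<close> and its successor.\<close>
    have "{t\<in>?T. real t - 2 < ?h \<and> ?h \<le> real t} \<subseteq> {nat \<lceil>?h\<rceil>, nat \<lceil>?h\<rceil> + 1}"
    proof
      fix t assume "t \<in> {t\<in>?T. real t - 2 < ?h \<and> ?h \<le> real t}"
      then have "\<lceil>?h\<rceil> \<le> int t" "int t \<le> \<lceil>?h\<rceil> + 1" by (simp_all add: ceiling_le_iff) linarith
      then show "t \<in> {nat \<lceil>?h\<rceil>, nat \<lceil>?h\<rceil> + 1}" by auto
    qed
    then have "card {t\<in>?T. real t - 2 < ?h \<and> ?h \<le> real t} \<le> card {nat \<lceil>?h\<rceil>, nat \<lceil>?h\<rceil> + 1}"
      by (intro card_mono) auto
    then have "card {t\<in>?T. real t - 2 < ?h \<and> ?h \<le> real t} \<le> 2" by simp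
    then show "(\<Sum>t\<in>?T. if real t - 2 < ?h \<and> ?h \<le> real t then measure lborel (x_range s) else 0)
        \<le> 2 * measure lborel (x_range s)"
      by (simp add: sum.If_cases Int_def mult_right_mono)
  qed
  also have "\<dots> = 2 * (\<Sum>s\<in>{s\<in>F. \<not> vertical s}. measure lborel (x_range s))"
    by (simp add: sum_distrib_left)
  finally have sum_W: "(\<Sum>t\<in>?T. W t) \<le> 2 * (\<Sum>s\<in>{s\<in>F. \<not> vertical s}. measure lborel (x_range s))" .
  have "real m * real (\<Sum>t\<in>?T. k t) \<le> (\<Sum>t\<in>?T. V t + W t)"
    unfolding of_nat_sum sum_distrib_left by (intro sum_mono gain)
  also have "\<dots> \<le> 2 * rsa_cost F"
    using sum_V sum_W sum_nonneg[of "{s\<in>F. vertical s}" "\<lambda>s. measure lborel (y_range s)"]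
    by (simp add: sum.distrib rsa_cost_split[OF F])
  finally have "real m * real (\<Sum>t\<in>?T. k t) \<le> 2 * rsa_cost (sol (requests k pre n))" by (simp only: F_def)
  moreover have "\<forall>t\<in>{1..n}. t < (m + 1) ^ m \<longrightarrow> k t = 1"
    using past(3) unfolding good_offset_def by blast
  ultimately show thesis using that k(1) by blast
qed

section \<open>Prefixes and admissibility of the request sequence\<close>

lemma requests_split:
  assumes "t \<le> n"
  obtains E where "requests k pre n = requests k pre t @ E" "\<forall>r\<in>set E. t < snd r"
proof -
  from assms have "\<exists>E. requests k pre n = requests k pre t @ E \<and> (\<forall>r\<in>set E. t < snd r)"
  proof (induction n rule: dec_induct)
    case (step n)
    then obtain E where "requests k pre n = requests k pre t @ E" "\<forall>r\<in>set E. t < snd r" by blast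
    with step.hyps show ?case
      by (intro exI[of _ "E @ [(Suc n - k (Suc n), Suc n), (Suc n, Suc n)]"]) auto
  qed simp
  with that show thesis by blast
qed

lemma length_requests: "length (requests k pre n) = length pre + 2 * n"
  by (induction n) auto

lemma dmcd_input_requests:
  assumes k: "valid_offsets k" and pre: "distinct pre" "set pre \<subseteq> {(0, 0)}"
  shows "dmcd_input n 0 (requests k pre n)"
proof -
  have le: "\<forall>r\<in>set (requests k pre t). fst r \<le> t \<and> snd r \<le> t" for t
    using pre(2) by (auto simp: set_requests)
  have "distinct (requests k pre n) \<and> sorted (map snd (requests k pre n))"
  proof (induction n)
    case 0
    have "sorted (map snd pre)" using pre
      by (cases pre; cases "tl pre") auto
    with pre(1) show ?case by simp
  next
    case (Suc n)
    have "1 \<le> k (Suc n)" using k by (simp add: valid_offsets_def)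
    moreover have "(Suc n - k (Suc n), Suc n) \<notin> set (requests k pre n)"
      "(Suc n, Suc n) \<notin> set (requests k pre n)" "\<forall>r\<in>set (requests k pre n). snd r \<le> Suc n"
      using le[of n] by force+
    ultimately show ?case using Suc by (simp add: sorted_append)
  qed
  with le[of n] show ?thesis by (auto simp: dmcd_input_def)
qed

section \<open>The optimum\<close>

definition staircase :: "(nat \<Rightarrow> nat) \<Rightarrow> nat \<Rightarrow> edge set" where
  "staircase k n = (\<Union>t\<in>{1..n}. {((t - 1, t - 1), (t - 1, t)), ((t - 1, t), (t, t))} \<union>
     (\<lambda>s. ((t - k t, s), (t - k t, s + 1))) ` {t - k t..<t})"

lemma card_staircase:
  assumes "valid_offsets k"
  shows "card (staircase k n) \<le> (\<Sum>t=1..n. 2 + k t)"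
proof -
  have "card (staircase k n) \<le> (\<Sum>t=1..n. card ({((t - 1, t - 1), (t - 1, t)), ((t - 1, t), (t, t))} \<union>
     (\<lambda>s. ((t - k t, s), (t - k t, s + 1))) ` {t - k t..<t}))"
    unfolding staircase_def by (rule card_UN_le) simp
  also have "\<dots> \<le> (\<Sum>t=1..n. 2 + k t)"
  proof (rule sum_mono)
    fix t assume "t \<in> {1..n}"
    with assms have "k t \<le> t" by (auto simp: valid_offsets_def)
    then have "card ((\<lambda>s. ((t - k t, s), (t - k t, s + 1))) ` {t - k t..<t}) \<le> k t"
      using card_image_le[of "{t - k t..<t}" "\<lambda>s. ((t - k t, s), (t - k t, s + 1))"] by simp
    moreover have "card {((t - 1, t - 1), (t - 1, t)), ((t - 1, t), (t, t))} \<le> 2"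
      by (simp add: card_insert_if)
    ultimately show "card ({((t - 1, t - 1), (t - 1, t)), ((t - 1, t), (t, t))} \<union>
     (\<lambda>s. ((t - k t, s), (t - k t, s + 1))) ` {t - k t..<t}) \<le> 2 + k t"
      by (meson add_mono card_Un_le order_trans)
  qed
  finally show ?thesis .
qed

text \<open>The diagonal reaches every \<open>(t, t)\<close>; the path to
  \<open>(t - k t, t)\<close> leaves it at \<open>(t - k t, t - k t)\<close> and goes straight
  up.\<close>

lemma dmcd_feasible_staircase:
  assumes k: "valid_offsets k" and pre: "set pre \<subseteq> {(0, 0)}"
  shows "dmcd_feasible n 0 (set (requests k pre n)) (staircase k n)"
proof -
  let ?F = "staircase k n"
  have diagonal: "((0, 0), (t, t)) \<in> ?F\<^sup>*" if "t \<le> n" for t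
    using that
  proof (induction t)
    case (Suc t)
    have "((t, t), (t, Suc t)) \<in> ?F" "((t, Suc t), (Suc t, Suc t)) \<in> ?F"
      unfolding staircase_def using Suc.prems by (auto intro!: bexI[of _ "Suc t"])
    with Suc show ?case by (meson Suc_leD rtrancl.rtrancl_into_rtrancl)
  qed simp
  have column: "((t - k t, t - k t), (t - k t, s)) \<in> ?F\<^sup>*" if "t \<in> {1..n}" "t - k t \<le> s" "s \<le> t" for t s
    using that(2,3)
  proof (induction s rule: dec_induct)
    case (step s)
    have "((t - k t, s), (t - k t, Suc s)) \<in> ?F"
      unfolding staircase_def using step that(1) by (auto intro!: bexI[of _ t])
    with step show ?case by (meson Suc_leD rtrancl.rtrancl_into_rtrancl)
  qed simp
  have "((0, 0), r) \<in> ?F\<^sup>*" if "r \<in> set (requests k pre n)" for r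
  proof -
    have "((0, 0), (t - k t, t)) \<in> ?F\<^sup>*" if "t \<in> {1..n}" for t
      using diagonal[of "t - k t"] column[of t t] that by (meson atLeastAtMost_iff diff_le_self order.trans order_refl rtrancl_trans)
    with that pre diagonal show ?thesis by (auto simp: set_requests)
  qed
  moreover have "finite ?F" by (simp add: staircase_def)
  moreover have "e \<in> timeline_edges n" if "e \<in> ?F" for e
  proof -
    from that obtain t where t: "t \<in> {1..n}"
      "e \<in> {((t - 1, t - 1), (t - 1, t)), ((t - 1, t), (t, t))} \<union>
         (\<lambda>s. ((t - k t, s), (t - k t, s + 1))) ` {t - k t..<t}"
      unfolding staircase_def by blast
    then obtain u where "t = Suc u" by (cases t) auto
    with t have "e \<in> horizontal_edges n (snd (fst e)) \<union> arcs n (snd (fst e))"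
      by (auto simp: horizontal_edges_def arcs_def)
    then show ?thesis unfolding timeline_edges_def by blast
  qed
  ultimately show ?thesis unfolding dmcd_feasible_def by blast
qed

section \<open>DMCD edges as unit segments in the plane\<close>

abbreviation unit_segment :: "edge \<Rightarrow> segment" where
  "unit_segment \<equiv> map_prod embed embed"

lemma inj_unit_segment: "inj_on unit_segment A"
  by (auto simp: inj_on_def embed_def)

text \<open>The four facts carry over, in this order, the cost, the shape of the segments, the
  online restriction and the steps of paths.\<close>

lemma unit_segment_edge:
  assumes "e \<in> timeline_edges n"
  shows "dist (fst (unit_segment e)) (snd (unit_segment e)) = 1" "axis_parallel (unit_segment e)"
    "segment_points (unit_segment e) \<subseteq> {q. real (snd (fst e)) \<le> snd q}"
    "e \<in> F \<Longrightarrow> unit_segment e \<in> monotone_moves (unit_segment ` F)"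
proof -
  from assms obtain u t where e: "e = ((u, t), (u + 1, t)) \<or> e = ((u, t), (u, t + 1))"
    by (auto simp: timeline_edges_def horizontal_edges_def arcs_def)
  then show "dist (fst (unit_segment e)) (snd (unit_segment e)) = 1" "axis_parallel (unit_segment e)"
    by (auto simp: embed_def dist_prod_def dist_real_def axis_parallel_def)
  show "segment_points (unit_segment e) \<subseteq> {q. real (snd (fst e)) \<le> snd q}"
    using e by (auto simp: closed_segment_eq_real_ivl embed_def dest!: segment_pointsD)
  show "unit_segment e \<in> monotone_moves (unit_segment ` F)" if "e \<in> F"
  proof -
    have "segment_points (unit_segment e) \<subseteq> (\<Union>s\<in>unit_segment ` F. segment_points s)"
      using that by blast
    with e show ?thesis by (auto simp: monotone_moves_def embed_def segment_points_def)
  qed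
qed

lemma rsa_feasible_unit_segments:
  assumes "dmcd_feasible n 0 R F"
  shows "rsa_feasible (embed ` R) (unit_segment ` F)"
proof -
  have F: "finite F" "F \<subseteq> timeline_edges n" "\<forall>r\<in>R. ((0, 0), r) \<in> F\<^sup>*"
    using assms by (auto simp: dmcd_feasible_def)
  have "(embed a, embed b) \<in> (monotone_moves (unit_segment ` F))\<^sup>*" if "(a, b) \<in> F\<^sup>*" for a b
    using that
  proof induction
    case (step b c)
    then show ?case using unit_segment_edge(4)[of "(b, c)" n F] F(2)
      by (auto intro: rtrancl_into_rtrancl)
  qed simp
  moreover have "embed (0, 0) = (0, 0)" by (simp add: embed_def)
  ultimately have "\<forall>p\<in>embed ` R. ((0, 0), p) \<in> (monotone_moves (unit_segment ` F))\<^sup>*"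
    using F(3) by force
  moreover have "\<forall>s\<in>unit_segment ` F. axis_parallel s"
    by (rule ballI, erule imageE) (simp only: unit_segment_edge(2)[OF subsetD[OF F(2)]])
  ultimately show ?thesis using F(1) unfolding rsa_feasible_def by blast
qed

lemma rsa_cost_unit_segments:
  assumes "F \<subseteq> timeline_edges n"
  shows "rsa_cost (unit_segment ` F) = real (card F)"
proof -
  have "rsa_cost (unit_segment ` F) = (\<Sum>e\<in>F. dist (fst (unit_segment e)) (snd (unit_segment e)))"
    unfolding rsa_cost_def by (rule sum.reindex_cong[OF inj_unit_segment refl refl])
  also have "\<dots> = (\<Sum>e\<in>F. 1)"
    using unit_segment_edge(1)[OF subsetD[OF assms]] by (intro sum.cong refl)
  finally show ?thesis by simp
qed

text \<open>A path to height at least 1 uses a column at every height in \<open>{0..<1}\<close>.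
  This keeps the optimum positive, so that the instances count in the competitive ratio.\<close>

lemma rsa_cost_ge_1:
  assumes "rsa_feasible P F" "p \<in> P" "1 \<le> snd p"
  shows "1 \<le> rsa_cost F"
proof -
  have F: "finite F" "\<forall>s\<in>F. axis_parallel s" and path: "((0, 0), p) \<in> (monotone_moves F)\<^sup>*"
    using assms by (auto simp: rsa_feasible_def)
  have "real 1 * (1 - 0) \<le> (\<Sum>s\<in>{s\<in>F. vertical s}. measure lborel ({0..<1} \<inter> y_range s))"
  proof (rule multiple_cover_bound[where E = "{}"])
    fix y :: real assume y: "0 \<le> y" "y < 1"
    obtain x where "x \<in> columns F y"
      using monotone_path_crossing[OF F path y(1)] y(2) assms(3) by auto
    then have "1 \<le> card (columns F y)"
      using card_columns_le(1)[OF F(1)] by (metis One_nat_def Suc_leI card_gt_0_iff empty_iff)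
    also have "\<dots> \<le> card {s\<in>F. vertical s \<and> y \<in> y_range s}" by (rule card_columns_le(2)[OF F(1)])
    finally show "1 \<le> card {s\<in>{s\<in>F. vertical s}. y \<in> y_range s}" by (simp add: conj_assoc)
  qed (use F in auto)
  also have "\<dots> \<le> (\<Sum>s\<in>{s\<in>F. vertical s}. measure lborel (y_range s))"
    by (intro sum_mono measure_mono_fmeasurable) (auto simp: closed_segment_eq_real_ivl fmeasurable_def)
  also have "\<dots> \<le> rsa_cost F"
    by (simp add: rsa_cost_split[OF F] sum_nonneg)
  finally show ?thesis by simp
qed

section \<open>Bounds on the two optima\<close>

lemma rsa_opt_requests:
  assumes "valid_offsets k" "set pre \<subseteq> {(0, 0)}" "1 \<le> n"
  shows "1 \<le> rsa_opt (embed ` set (requests k pre n))"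
    "rsa_opt (embed ` set (requests k pre n)) \<le> real (\<Sum>t=1..n. 2 + k t)"
proof -
  let ?P = "embed ` set (requests k pre n)"
  have feasible: "rsa_feasible ?P (unit_segment ` staircase k n)"
    using dmcd_feasible_staircase[OF assms(1,2)] by (rule rsa_feasible_unit_segments)
  have "(n, n) \<in> set (requests k pre n)" using assms(3) by (auto simp: set_requests)
  then have "embed (n, n) \<in> ?P" "1 \<le> snd (embed (n, n))"
    using assms(3) by (blast, simp add: embed_def)
  then have ge: "1 \<le> rsa_cost F" if "rsa_feasible ?P F" for F
    using rsa_cost_ge_1[OF that] by blast
  then show "1 \<le> rsa_opt ?P"
    unfolding rsa_opt_def using feasible by (intro cINF_greatest) auto
  \<comment> \<open>The bound \<open>ge\<close> also supplies the boundedness below that a real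
    infimum needs.\<close>
  have "rsa_opt ?P \<le> rsa_cost (unit_segment ` staircase k n)"
    unfolding rsa_opt_def using feasible ge by (intro cINF_lower bdd_belowI[of _ 1]) auto
  also have "\<dots> = real (card (staircase k n))"
    using dmcd_feasible_staircase[OF assms(1,2), of n]
    by (intro rsa_cost_unit_segments[of _ n]) (simp add: dmcd_feasible_def)
  also have "\<dots> \<le> real (\<Sum>t=1..n. 2 + k t)"
    using card_staircase[OF assms(1)] of_nat_mono by blast
  finally show "rsa_opt ?P \<le> real (\<Sum>t=1..n. 2 + k t)" .
qed

lemma dmcd_opt_requests:
  assumes "valid_offsets k" "set pre \<subseteq> {(0, 0)}" "1 \<le> n"
  shows "1 \<le> dmcd_opt n 0 (set (requests k pre n))"
    "dmcd_opt n 0 (set (requests k pre n)) \<le> (\<Sum>t=1..n. 2 + k t)"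
proof -
  let ?R = "set (requests k pre n)"
  have feasible: "dmcd_feasible n 0 ?R (staircase k n)"
    using dmcd_feasible_staircase[OF assms(1,2)] .
  have "(n, n) \<in> ?R" using assms(3) by (auto simp: set_requests)
  then have "embed (n, n) \<in> embed ` ?R" "1 \<le> snd (embed (n, n))"
    using assms(3) by (blast, simp add: embed_def)
  \<comment> \<open>A DMCD solution costs as much as its image in the plane, so the RSA bound
    applies.\<close>
  then have "1 \<le> card F" if "dmcd_feasible n 0 ?R F" for F
    using rsa_cost_ge_1[OF rsa_feasible_unit_segments[OF that]] rsa_cost_unit_segments[of F n] that
    by (auto simp: dmcd_feasible_def)
  then show "1 \<le> dmcd_opt n 0 ?R"
    unfolding dmcd_opt_def using feasible by (intro cINF_greatest) auto
  have "dmcd_opt n 0 ?R \<le> card (staircase k n)"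
    unfolding dmcd_opt_def using feasible by (intro cINF_lower) auto
  with card_staircase[OF assms(1), of n] show "dmcd_opt n 0 ?R \<le> (\<Sum>t=1..n. 2 + k t)" by simp
qed

section \<open>Online algorithms facing the adversary\<close>

text \<open>An online algorithm is constrained on admissible inputs only. Hence the prefixes handed
  to \<open>serve\<close> and the filtered lists handed to \<open>store\<close> must be admissible
  too.\<close>

lemma dmcd_input_take: "dmcd_input n origin rs \<Longrightarrow> dmcd_input n origin (take i rs)"
  using image_mono[OF set_take_subset, of fst i rs] sorted_wrt_take[of "(\<le>)" "map snd rs" i]
  unfolding dmcd_input_def take_map by (meson distinct_take order_trans)

lemma dmcd_input_filter: "dmcd_input n origin rs \<Longrightarrow> dmcd_input n origin (filter P rs)"
  using image_mono[OF filter_is_subset, of fst P rs] sorted_filter[of snd rs P]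
  unfolding dmcd_input_def by (meson distinct_filter order_trans)

lemma rsa_input_take: "rsa_input ps \<Longrightarrow> rsa_input (take i ps)"
  using set_take_subset[of i ps] sorted_wrt_take[of "(\<le>)" "map snd ps" i]
  unfolding rsa_input_def take_map by (meson distinct_take subsetD)

text \<open>This is the online restriction in the form that \<open>adversary\<close> needs. Later
  requests trigger horizontal edges at times after \<open>t\<close> and arcs from time
  \<open>t\<close> on; the step closing time \<open>t\<close> is not yet in the solution for
  \<open>H\<close>, so the bound is \<open>t\<close> and not \<open>t + 1\<close>.\<close>

lemma dmcd_solution_extend:
  assumes alg: "dmcd_online_algorithm n serve store" and input: "dmcd_input n origin (H @ E)"
    and H: "\<forall>r\<in>set H. snd r \<le> t" and E: "\<forall>r\<in>set E. t < snd r"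
    and last: "t = 0 \<or> (\<exists>r\<in>set H. snd r = t)"
  shows "dmcd_solution serve store origin H \<subseteq> dmcd_solution serve store origin (H @ E)"
    "e \<in> dmcd_solution serve store origin (H @ E) - dmcd_solution serve store origin H \<Longrightarrow>
       t \<le> snd (fst e)"
proof -
  have filter_H: "filter (\<lambda>r. snd r \<le> s) (H @ E) = filter (\<lambda>r. snd r \<le> s) H" if "s < t" for s
    using E that by (auto simp: filter_empty_conv)
  have serve_H: "(\<Union>i\<in>{1..length H}. serve origin (take i H)) =
      (\<Union>i\<in>{1..length H}. serve origin (take i (H @ E)))"
    by (intro SUP_cong) auto
  have early: "s < t" if "r \<in> set H" "s < snd r" for r s
    using H that by force
  show "dmcd_solution serve store origin H \<subseteq> dmcd_solution serve store origin (H @ E)"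
    unfolding dmcd_solution_def serve_H
  proof (rule Un_mono)
    show "(\<Union>s\<in>{s. \<exists>r\<in>set H. s < snd r}. store origin (filter (\<lambda>r. snd r \<le> s) H) s)
      \<subseteq> (\<Union>s\<in>{s. \<exists>r\<in>set (H @ E). s < snd r}. store origin (filter (\<lambda>r. snd r \<le> s) (H @ E)) s)"
    proof (rule UN_mono)
      fix s assume "s \<in> {s. \<exists>r\<in>set H. s < snd r}"
      then have "s < t" using early by blast
      then show "store origin (filter (\<lambda>r. snd r \<le> s) H) s \<subseteq> store origin (filter (\<lambda>r. snd r \<le> s) (H @ E)) s"
        by (simp only: filter_H order_refl)
    qed auto
  qed (rule UN_mono, auto simp del: take_append)
  assume e: "e \<in> dmcd_solution serve store origin (H @ E) - dmcd_solution serve store origin H"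
  then consider (serve) i where "i \<in> {1..length (H @ E)}" "i \<notin> {1..length H}" "e \<in> serve origin (take i (H @ E))"
    | (store) s where "\<not> s < t" "e \<in> store origin (filter (\<lambda>r. snd r \<le> s) (H @ E)) s"
  proof -
    from e have "e \<notin> (\<Union>i\<in>{1..length H}. serve origin (take i (H @ E)))"
      unfolding dmcd_solution_def serve_H by blast
    moreover have "e \<notin> store origin (filter (\<lambda>r. snd r \<le> s) (H @ E)) s" if "s < t" for s
    proof -
      \<comment> \<open>By \<open>last\<close>, the solution for \<open>H\<close> already contains
        the closing step of every time before \<open>t\<close>.\<close>
      have "\<exists>r\<in>set H. s < snd r" using last that by auto
      then show ?thesis using e filter_H[OF that] unfolding dmcd_solution_def by auto
    qed
    moreover have "(\<exists>i\<in>{1..length (H @ E)}. e \<in> serve origin (take i (H @ E))) \<or>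
        (\<exists>s. e \<in> store origin (filter (\<lambda>r. snd r \<le> s) (H @ E)) s)"
      using e unfolding dmcd_solution_def by (elim DiffE UnE UN_E) (intro disjI1 bexI, assumption+, intro disjI2 exI)
    ultimately show thesis using that by (meson UN_I)
  qed
  then show "t \<le> snd (fst e)"
  proof cases
    case serve
    let ?rs = "take i (H @ E)"
    from serve have i: "length H < i" "i \<le> length H + length E" by auto
    then have rs: "?rs = H @ take (i - length H) E" "take (i - length H) E \<noteq> []" by auto
    then have "last ?rs \<in> set E" by (metis in_set_takeD last_appendR last_in_set)
    moreover have "?rs \<noteq> []" using i by auto
    ultimately have "e \<in> horizontal_edges n (snd (last ?rs))" "t < snd (last ?rs)"
      using alg dmcd_input_take[OF input, of i] serve(3) E unfolding dmcd_online_algorithm_def by blast+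
    then show ?thesis by (auto simp: horizontal_edges_def)
  next
    case store
    have "\<forall>r\<in>set (filter (\<lambda>r. snd r \<le> s) (H @ E)). snd r \<le> s" by auto
    then have "store origin (filter (\<lambda>r. snd r \<le> s) (H @ E)) s \<subseteq> arcs n s"
      using alg dmcd_input_filter[OF input] unfolding dmcd_online_algorithm_def by blast
    with store have "e \<in> arcs n s" by blast
    with store(1) show ?thesis by (auto simp: arcs_def)
  qed
qed

text \<open>These are the conditions that \<open>dmcd_solution_extend\<close> puts on a prefix; for
  positive \<open>t\<close> the diagonal request \<open>(t, t)\<close> is the witness.\<close>

lemma last_request:
  assumes "set pre \<subseteq> {(0, 0)}"
  shows "\<forall>r\<in>set (requests k pre t). snd r \<le> t" "t = 0 \<or> (\<exists>r\<in>set (requests k pre t). snd r = t)"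
  using assms by (auto simp: set_requests) (cases t; force)

text \<open>\<open>adversary\<close> is applied to the images of the DMCD solutions under
  \<open>unit_segment\<close>, whose cost is the number of edges.\<close>

lemma dmcd_adversary:
  assumes alg: "dmcd_online_algorithm n serve store" and "1 \<le> m"
  obtains k where "valid_offsets k" "\<forall>t\<in>{1..n}. t < (m + 1) ^ m \<longrightarrow> k t = 1"
    "real m * real (\<Sum>t=(m + 1) ^ m..n. k t)
       \<le> 2 * real (card (dmcd_solution serve store 0 (requests k [] n)))"
proof -
  let ?sol = "\<lambda>rs. unit_segment ` dmcd_solution serve store 0 rs"
  have input: "dmcd_input n 0 (requests k [] n)" if "valid_offsets k" for k
    using dmcd_input_requests[OF that, of "[]" n] by simp
  have feasible: "dmcd_feasible n 0 (set (requests k [] n)) (dmcd_solution serve store 0 (requests k [] n))"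
    if "valid_offsets k" for k
    using alg input[OF that] by (simp add: dmcd_online_algorithm_def)
  have extend: "dmcd_solution serve store 0 (requests k [] t) \<subseteq> dmcd_solution serve store 0 (requests k [] n)"
    "e \<in> dmcd_solution serve store 0 (requests k [] n) - dmcd_solution serve store 0 (requests k [] t) \<Longrightarrow>
       t \<le> snd (fst e)" if vt: "valid_offsets k" "t \<le> n" for k t e
  proof -
    obtain E where E: "requests k [] n = requests k [] t @ E" "\<forall>r\<in>set E. t < snd r"
      using requests_split[OF vt(2), of k "[]"] by blast
    note * = dmcd_solution_extend[OF alg input[OF vt(1), unfolded E(1)] last_request(1) E(2) last_request(2)]
    show "dmcd_solution serve store 0 (requests k [] t) \<subseteq> dmcd_solution serve store 0 (requests k [] n)"
      unfolding E(1) by (rule *(1)) simp_all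
    show "e \<in> dmcd_solution serve store 0 (requests k [] n) - dmcd_solution serve store 0 (requests k [] t) \<Longrightarrow>
       t \<le> snd (fst e)"
      unfolding E(1) by (rule *(2)) simp_all
  qed
  have timeline: "dmcd_solution serve store 0 (requests k [] n) \<subseteq> timeline_edges n" if "valid_offsets k" for k
    using feasible[OF that] by (simp add: dmcd_feasible_def)
  obtain k where k: "valid_offsets k" "\<forall>t\<in>{1..n}. t < (m + 1) ^ m \<longrightarrow> k t = 1"
    "real m * real (\<Sum>t=(m + 1) ^ m..n. k t) \<le> 2 * rsa_cost (?sol (requests k [] n))"
  proof (rule adversary[of m "[]" n ?sol])
    show "segment_points s \<subseteq> {q. real t \<le> snd q}"
      if vt: "valid_offsets k" "t \<le> n" and s: "s \<in> ?sol (requests k [] n) - ?sol (requests k [] t)" for k t s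
    proof -
      from s obtain e where e: "s = unit_segment e" "e \<in> dmcd_solution serve store 0 (requests k [] n)"
        by (elim DiffE imageE)
      moreover from s e(1) have "e \<notin> dmcd_solution serve store 0 (requests k [] t)"
        by (metis DiffD2 imageI)
      ultimately have "t \<le> snd (fst e)" using extend(2)[OF vt] by blast
      moreover have "segment_points s \<subseteq> {q. real (snd (fst e)) \<le> snd q}"
        unfolding e(1) using timeline[OF vt(1)] e(2) by (intro unit_segment_edge(3)) blast
      ultimately show ?thesis by force
    qed
    show "?sol (requests k [] t) \<subseteq> ?sol (requests k [] n)" if "valid_offsets k" "t \<le> n" for k t
      by (rule image_mono[OF extend(1)[OF that]])
    show "rsa_feasible (embed ` set (requests k [] n)) (?sol (requests k [] n))" if "valid_offsets k" for k
      by (rule rsa_feasible_unit_segments[OF feasible[OF that]])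
  qed (use \<open>1 \<le> m\<close> in auto)
  with that show thesis by (simp add: rsa_cost_unit_segments[OF timeline[OF k(1)]])
qed

section \<open>Online RSA against the adversary\<close>

lemma rsa_input_embed:
  assumes "dmcd_input n origin rs"
  shows "rsa_input (map embed rs)"
proof -
  have "inj_on embed (set rs)" by (auto simp: inj_on_def embed_def)
  moreover have "sorted (map (snd \<circ> embed) rs)"
    using assms unfolding dmcd_input_def
    by (auto simp: sorted_map embed_def elim: sorted_wrt_mono_rel[rotated])
  ultimately show ?thesis
    using assms by (auto simp: rsa_input_def dmcd_input_def distinct_map embed_def comp_def)
qed

text \<open>A segment added after \<open>H\<close> must stay above the preceding point, which is the
  last point of \<open>H\<close> or a later one, hence at height at least \<open>t\<close>. For
  \<open>t = 0\<close> and empty \<open>H\<close> the origin takes this role.\<close>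

lemma rsa_solution_extend:
  assumes alg: "rsa_online_algorithm alg" and input: "rsa_input (H @ E)"
    and t: "t = 0 \<or> (\<exists>p\<in>set H. snd p = t)"
  shows "rsa_solution alg H \<subseteq> rsa_solution alg (H @ E)"
    "s \<in> rsa_solution alg (H @ E) - rsa_solution alg H \<Longrightarrow> segment_points s \<subseteq> {q. t \<le> snd q}"
proof -
  have sol_H: "rsa_solution alg H = (\<Union>i\<in>{1..length H}. alg (take i (H @ E)))"
    unfolding rsa_solution_def by (intro SUP_cong) auto
  then show "rsa_solution alg H \<subseteq> rsa_solution alg (H @ E)"
    unfolding rsa_solution_def by (metis UN_mono atLeastatMost_subset_iff le_add1 length_append order_refl)
  assume "s \<in> rsa_solution alg (H @ E) - rsa_solution alg H"
  then obtain i where i: "i \<in> {1..length (H @ E)}" "i \<notin> {1..length H}" and s: "s \<in> alg (take i (H @ E))"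
    unfolding sol_H rsa_solution_def[of _ "H @ E"] by blast
  let ?ps = "take i (H @ E)"
  from i have "length H < i" "i \<le> length (H @ E)" by auto
  then have butlast: "butlast ?ps = take (i - 1) (H @ E)" "take (i - 1) (H @ E) = H @ take (i - 1 - length H) E"
    by (simp_all only: butlast_take) simp
  have "?ps \<noteq> []" using \<open>length H < i\<close> i by auto
  have "t \<le> previous_height ?ps"
  proof -
    \<comment> \<open>With the origin in front the list is still sorted by height, so its last entry
      dominates every height in it, including \<open>t\<close>.\<close>
    define qs where "qs = (0, 0) # butlast ?ps"
    have "rsa_input (butlast ?ps)"
      using rsa_input_take[OF input, of "i - 1"] butlast(1) by simp
    then have qs: "sorted (map snd qs)"
      by (auto simp: rsa_input_def qs_def)
    have "t \<in> set (map snd qs)" using t unfolding qs_def butlast by auto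
    then obtain j where "j < length qs" "t = map snd qs ! j"
      by (metis in_set_conv_nth length_map)
    then have "t \<le> map snd qs ! (length qs - 1)"
      using sorted_nth_mono[OF qs, of j "length qs - 1"] by simp
    also have "\<dots> = snd (last qs)"
      using \<open>j < length qs\<close> by (subst last_conv_nth) auto
    finally show ?thesis by (simp only: previous_height_def qs_def)
  qed
  moreover have "segment_points s \<subseteq> {q. previous_height ?ps \<le> snd q}"
    using alg rsa_input_take[OF input, of i] \<open>?ps \<noteq> []\<close> s unfolding rsa_online_algorithm_def by blast
  ultimately show "segment_points s \<subseteq> {q. t \<le> snd q}" by force
qed

lemma rsa_adversary:
  assumes alg: "rsa_online_algorithm alg" and "1 \<le> m" and pre: "distinct pre" "set pre \<subseteq> {(0, 0)}"
  obtains k where "valid_offsets k" "\<forall>t\<in>{1..n}. t < (m + 1) ^ m \<longrightarrow> k t = 1"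
    "real m * real (\<Sum>t=(m + 1) ^ m..n. k t)
       \<le> 2 * rsa_cost (rsa_solution alg (map embed (requests k pre n)))"
proof -
  have input: "rsa_input (map embed (requests k pre n))" if "valid_offsets k" for k
    using rsa_input_embed[OF dmcd_input_requests[OF that pre]] .
  have extend: "rsa_solution alg (map embed (requests k pre t)) \<subseteq> rsa_solution alg (map embed (requests k pre n))"
    "s \<in> rsa_solution alg (map embed (requests k pre n)) - rsa_solution alg (map embed (requests k pre t)) \<Longrightarrow>
       segment_points s \<subseteq> {q. real t \<le> snd q}" if vt: "valid_offsets k" "t \<le> n" for k t s
  proof -
    obtain E where E: "requests k pre n = requests k pre t @ E"
      using requests_split[OF vt(2), of k pre] by blast
    have "real t = 0 \<or> (\<exists>p\<in>set (map embed (requests k pre t)). snd p = real t)"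
      using last_request(2)[OF pre(2), of t k] by (auto simp: embed_def)
    note * = rsa_solution_extend[OF alg input[OF vt(1), unfolded E map_append] this]
    show "rsa_solution alg (map embed (requests k pre t)) \<subseteq> rsa_solution alg (map embed (requests k pre n))"
      unfolding E map_append by (rule *(1))
    show "s \<in> rsa_solution alg (map embed (requests k pre n)) - rsa_solution alg (map embed (requests k pre t)) \<Longrightarrow>
       segment_points s \<subseteq> {q. real t \<le> snd q}"
      unfolding E map_append by (rule *(2))
  qed
  show thesis
  proof (rule adversary[of m pre n "\<lambda>rs. rsa_solution alg (map embed rs)"])
    show "rsa_feasible (embed ` set (requests k pre n)) (rsa_solution alg (map embed (requests k pre n)))"
      if "valid_offsets k" for k
      using alg input[OF that] unfolding rsa_online_algorithm_def by (metis set_map)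
  qed (use \<open>1 \<le> m\<close> extend that in blast)+
qed

section \<open>The competitive ratios\<close>

text \<open>Let \<open>S\<close> be the sum on the right. At least half of the rounds lie in
  \<open>{D..n}\<close>, each with offset at least 1, so \<open>n <= 2 * S\<close> and
  \<open>D - 1 <= S\<close>. The left-hand side is \<open>2 * n + (D - 1) + S\<close>, at most
  \<open>6 * S\<close>.\<close>

lemma offset_sum_bound:
  assumes k: "valid_offsets k" "\<forall>t\<in>{1..n}. t < D \<longrightarrow> k t = 1" and D: "1 \<le> D" "2 * D \<le> n"
  shows "(\<Sum>t=1..n. 2 + k t) \<le> 7 * (\<Sum>t=D..n. k t)"
proof -
  let ?S = "\<Sum>t=D..n. k t"
  have split: "{1..n} = {1..<D} \<union> {D..n}" using D by auto
  have "(\<Sum>t=1..n. k t) = (\<Sum>t\<in>{1..<D}. k t) + ?S"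
    unfolding split by (rule sum.union_disjoint) auto
  moreover have "(\<Sum>t=1..n. 2 + k t) = 2 * n + (\<Sum>t=1..n. k t)"
    unfolding sum.distrib by simp
  moreover have "(\<Sum>t\<in>{1..<D}. k t) = (\<Sum>t\<in>{1..<D}. 1)"
    using k(2) D(2) by (intro sum.cong) auto
  moreover have "(\<Sum>t\<in>{D..n}. 1) \<le> ?S"
    using k(1) D(1) by (intro sum_mono) (auto simp: valid_offsets_def)
  ultimately show ?thesis using D by simp
qed

text \<open>The constant 14 is the factor 2 of \<open>adversary\<close> times the factor 7 of
  \<open>offset_sum_bound\<close>.\<close>

lemma ratio_bound:
  assumes k: "valid_offsets k" "\<forall>t\<in>{1..n}. t < (m + 1) ^ m \<longrightarrow> k t = 1"
    and m: "1 \<le> m" "2 * (m + 1) ^ m \<le> n"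
    and cost: "real m * real (\<Sum>t=(m + 1) ^ m..n. k t) \<le> 2 * cost"
    and opt: "opt \<le> real (\<Sum>t=1..n. 2 + k t)" "0 < opt"
  shows "real m / 14 \<le> cost / opt"
proof -
  have "opt \<le> 7 * real (\<Sum>t=(m + 1) ^ m..n. k t)"
    using of_nat_mono[OF offset_sum_bound[OF k _ m(2)], where 'a = real] opt(1) by simp
  then have "real m * opt \<le> real m * (7 * real (\<Sum>t=(m + 1) ^ m..n. k t))"
    by (intro mult_left_mono) auto
  with cost opt(2) show ?thesis by (simp add: field_simps)
qed

text \<open>Take \<open>m\<close> as the floor of \<open>x = ln N / (2 * ln (ln N))\<close>. Then
  \<open>m + 1 <= ln N\<close>, so \<open>(m + 1) ^ m\<close> is at most
  \<open>exp (x * ln (ln N)) = sqrt N\<close>, which is at most \<open>N / 4\<close>. Since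
  \<open>x\<close> is at least 2, rounding leaves \<open>m\<close> at least \<open>x / 2\<close>.
  The factor 4 accounts for RSA, where \<open>N\<close> points make only \<open>N div 2\<close>
  rounds.\<close>

lemma parameter_exists:
  "\<exists>N0::nat. \<forall>N\<ge>N0. \<exists>m\<ge>1. 4 * (m + 1) ^ m \<le> N \<and> ln (real N) / ln (ln (real N)) / 4 \<le> real m"
proof -
  have "eventually (\<lambda>N::nat. 2 \<le> ln N / (2 * ln (ln N)) \<and> ln N / (2 * ln (ln N)) + 1 \<le> ln N \<and>
      0 < ln (ln N) \<and> 1 < ln N \<and> 4 * sqrt N \<le> N) at_top"
    by (intro eventually_conj) real_asymp+
  then obtain N0 where N0: "\<And>N. N0 \<le> N \<Longrightarrow> 2 \<le> ln (real N) / (2 * ln (ln (real N))) \<and>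
      ln (real N) / (2 * ln (ln (real N))) + 1 \<le> ln (real N) \<and> 0 < ln (ln (real N)) \<and> 1 < ln (real N) \<and>
      4 * sqrt (real N) \<le> real N"
    by (auto simp: eventually_at_top_linorder)
  show ?thesis
  proof (rule exI[of _ N0], intro allI impI)
    fix N assume "N0 \<le> N"
    define x where "x = ln (real N) / (2 * ln (ln (real N)))"
    have N: "2 \<le> x" "x + 1 \<le> ln (real N)" "0 < ln (ln (real N))" "1 < ln (real N)" "4 * sqrt (real N) \<le> real N"
      using N0[OF \<open>N0 \<le> N\<close>] by (auto simp: x_def)
    then have "0 < real N" by (cases N) auto
    define m where "m = nat \<lfloor>x\<rfloor>"
    have m: "real m \<le> x" "x - 1 \<le> real m" "1 \<le> m"
      using N(1) unfolding m_def by linarith+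
    have "real ((m + 1) ^ m) \<le> ln (real N) ^ m"
      unfolding of_nat_power using m(1) N(2) by (intro power_mono) auto
    also have "\<dots> = exp (real m * ln (ln (real N)))"
      using N(4) by (simp add: exp_of_nat_mult)
    also have "\<dots> \<le> exp (x * ln (ln (real N)))"
      using m(1) N(3) by simp
    also have "\<dots> = sqrt (real N)"
      using N(3) \<open>0 < real N\<close> by (simp add: x_def ln_sqrt[symmetric])
    finally have "real (4 * (m + 1) ^ m) \<le> real N" using N(5) by simp
    then have "4 * (m + 1) ^ m \<le> N" by linarith
    moreover have "ln (real N) / ln (ln (real N)) / 4 = x / 2" by (simp add: x_def)
    then have "ln (real N) / ln (ln (real N)) / 4 \<le> real m" using m(2) N(1) by linarith
    ultimately show "\<exists>m\<ge>1. 4 * (m + 1) ^ m \<le> N \<and> ln (real N) / ln (ln (real N)) / 4 \<le> real m"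
      using m(3) by blast
  qed
qed

lemma dmcd_competitive_ratio_ge:
  assumes "dmcd_online_algorithm n serve store" "1 \<le> m" "2 * (m + 1) ^ m \<le> n"
  shows "ereal (real m / 14) \<le> dmcd_competitive_ratio n serve store"
proof -
  obtain k where k: "valid_offsets k" "\<forall>t\<in>{1..n}. t < (m + 1) ^ m \<longrightarrow> k t = 1" "real m * real (\<Sum>t=(m + 1) ^ m..n. k t)
       \<le> 2 * real (card (dmcd_solution serve store 0 (requests k [] n)))"
    using dmcd_adversary[OF assms(1,2)] by blast
  have "1 \<le> (m + 1) ^ m" by simp
  then have "1 \<le> n" using assms(3) by linarith
  note opt = dmcd_opt_requests[OF k(1), of "[]", OF _ this]
  let ?rs = "requests k [] n"
  have "real m / 14 \<le> real (card (dmcd_solution serve store 0 ?rs)) / real (dmcd_opt n 0 (set ?rs))"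
    using opt by (intro ratio_bound[OF k(1,2) assms(2,3) k(3)]) (simp_all flip: of_nat_sum)
  moreover have "(0, ?rs) \<in> {(origin, rs). dmcd_input n origin rs \<and> 0 < dmcd_opt n origin (set rs)}"
    using dmcd_input_requests[OF k(1), of "[]" n] opt(1) by simp
  ultimately show ?thesis
    unfolding dmcd_competitive_ratio_def by (intro SUP_upper2) auto
qed

text \<open>For odd \<open>N\<close> the surplus request is the origin itself, which costs nothing.\<close>

lemma rsa_competitive_ratio_ge:
  assumes "rsa_online_algorithm alg" "1 \<le> m" "4 * (m + 1) ^ m \<le> N"
  shows "ereal (real m / 14) \<le> rsa_competitive_ratio N alg"
proof -
  define n where "n = N div 2"
  define pre :: "replica list" where "pre = (if even N then [] else [(0, 0)])"
  have pre: "distinct pre" "set pre \<subseteq> {(0, 0)}" by (auto simp: pre_def)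
  have n: "2 * (m + 1) ^ m \<le> n" using assms(3) by (simp add: n_def)
  obtain k where k: "valid_offsets k" "\<forall>t\<in>{1..n}. t < (m + 1) ^ m \<longrightarrow> k t = 1" "real m * real (\<Sum>t=(m + 1) ^ m..n. k t)
       \<le> 2 * rsa_cost (rsa_solution alg (map embed (requests k pre n)))"
    using rsa_adversary[OF assms(1,2) pre] by blast
  have "1 \<le> (m + 1) ^ m" by simp
  then have "1 \<le> n" using n by linarith
  note opt = rsa_opt_requests[OF k(1) pre(2) this]
  let ?ps = "map embed (requests k pre n)"
  have "real m / 14 \<le> rsa_cost (rsa_solution alg ?ps) / rsa_opt (set ?ps)"
    using opt by (intro ratio_bound[OF k(1,2) assms(2) n k(3)]) simp_all
  moreover have "length ?ps = N"
    by (auto simp: length_requests pre_def n_def)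
  moreover have "rsa_input ?ps"
    using rsa_input_embed[OF dmcd_input_requests[OF k(1) pre]] .
  ultimately show ?thesis
    unfolding rsa_competitive_ratio_def using opt(1) by (intro SUP_upper2) auto
qed

theorem theorem5:
  "(\<exists>c::real. c > 0 \<and> (\<exists>n0::nat. \<forall>n\<ge>n0. \<forall>serve store.
      dmcd_online_algorithm n serve store \<longrightarrow>
        dmcd_competitive_ratio n serve store \<ge> ereal (c * (ln (real n) / ln (ln (real n)))))) \<and>
   (\<exists>c::real. c > 0 \<and> (\<exists>N0::nat. \<forall>N\<ge>N0. \<forall>alg.
      rsa_online_algorithm alg \<longrightarrow>
        rsa_competitive_ratio N alg \<ge> ereal (c * (ln (real N) / ln (ln (real N))))))"
proof -
  obtain N0 :: nat where N0: "\<And>N. N0 \<le> N \<Longrightarrow>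
      \<exists>m\<ge>1. 4 * (m + 1) ^ m \<le> N \<and> ln (real N) / ln (ln (real N)) / 4 \<le> real m"
    using parameter_exists by blast
  \<comment> \<open>The constant 56 is 14 from \<open>ratio_bound\<close> times 4 from
    \<open>parameter_exists\<close>.\<close>
  have dmcd: "ereal (1 / 56 * (ln (real n) / ln (ln (real n)))) \<le> dmcd_competitive_ratio n serve store"
    if n: "N0 \<le> n" and alg: "dmcd_online_algorithm n serve store" for n serve store
  proof -
    obtain m where m: "1 \<le> m" "4 * (m + 1) ^ m \<le> n" "ln (real n) / ln (ln (real n)) / 4 \<le> real m"
      using N0[OF n] by blast
    have "ereal (1 / 56 * (ln (real n) / ln (ln (real n)))) \<le> ereal (real m / 14)" using m(3) by simp
    also have "\<dots> \<le> dmcd_competitive_ratio n serve store"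
      using alg m(1,2) by (intro dmcd_competitive_ratio_ge) auto
    finally show ?thesis .
  qed
  have rsa: "ereal (1 / 56 * (ln (real N) / ln (ln (real N)))) \<le> rsa_competitive_ratio N alg"
    if N: "N0 \<le> N" and alg: "rsa_online_algorithm alg" for N alg
  proof -
    obtain m where m: "1 \<le> m" "4 * (m + 1) ^ m \<le> N" "ln (real N) / ln (ln (real N)) / 4 \<le> real m"
      using N0[OF N] by blast
    have "ereal (1 / 56 * (ln (real N) / ln (ln (real N)))) \<le> ereal (real m / 14)" using m(3) by simp
    also have "\<dots> \<le> rsa_competitive_ratio N alg"
      using alg m(1,2) by (intro rsa_competitive_ratio_ge) auto
    finally show ?thesis .
  qed
  have "(0::real) < 1 / 56" by simp
  with dmcd rsa show ?thesis by blast
qed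

end
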